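(* The fractional optimal control problem: minimize $J(\mathsf{u},\mathsf{z})$ subject to the state equation $\mathcal{L}^s\mathsf{u}=\mathsf{z}$ in $\Omega$ and the control constraint $\mathsf{z}\in\mathsf{Z}_{\rm ad}$, has a unique optimal solution $(\bar{\mathsf{u}},\bar{\mathsf{z}})\in\mathbb{H}^s(\Omega)\times\mathsf{Z}_{\rm ad}$. That is, there is exactly one pair $(\bar{\mathsf{u}},\bar{\mathsf{z}})\in\mathbb{H}^s(\Omega)\times\mathsf{Z}_{\rm ad}$ such that $\bar{\mathsf{u}}=\mathbf{S}\bar{\mathsf{z}}$ and $J(\bar{\mathsf{u}},\bar{\mathsf{z}})\le J(\mathsf{u},\mathsf{z})$ for all $(\mathsf{u},\mathsf{z})\in\mathbb{H}^s(\Omega)\times\mathsf{Z}_{\rm ad}$ with $\mathsf{u}=\mathbf{S}\mathsf{z}$.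
   Context: Let $n\ge 1$, let $\Omega\subset\mathbb{R}^n$ be a bounded, open, convex polytopal domain, and let $s\in(0,1)$. Let $\mathcal{L}w=-\mathrm{div}(A\nabla w)+c\,w$ with homogeneous Dirichlet boundary conditions, where $0\le c\in L^\infty(\Omega)$ and $A\in C^{0,1}(\Omega,\mathrm{GL}(n,\mathbb{R}))$ is symmetric and (uniformly) positive definite. Let $\{(\lambda_k,\varphi_k)\}_{k\in\mathbb{N}}\subset\mathbb{R}_+\times H_0^1(\Omega)$ be the eigenpairs of $\mathcal{L}$ ($\mathcal{L}\varphi_k=\lambda_k\varphi_k$ in $\Omega$, $\varphi_k=0$ on $\partial\Omega$), with $\{\varphi_k\}$ an orthonormal basis of $L^2(\Omega)$. For $w=\sum_k w_k\varphi_k$ with $w_k=\int_\Omega w\varphi_k\,dx'$, set $\mathcal{L}^s w=\sum_k\lambda_k^s w_k\varphi_k$ and $\mathbb{H}^s(\Omega)=\{w\in L^2(\Omega):\|w\|_{\mathbb{H}^s(\Omega)}^2:=\sum_k\lambda_k^s|w_k|^2<\infty\}$; $\mathcal{L}^s$ is an isomorphism from $\mathbb{H}^s(\Omega)$ onto its dual $\mathbb{H}^{-s}(\Omega)$. The control to state map $\mathbf{S}:L^2(\Omega)\to\mathbb{H}^s(\Omega)$ sends $\mathsf{z}$ to the unique solution $\mathsf{u}\in\mathbb{H}^s(\Omega)$ of $\mathcal{L}^s\mathsf{u}=\mathsf{z}$. Let $\sigma,\nu>0$, let $\mathsf{u}_{\rm d}\in L^2(\Omega)$, and let $\mathsf{a},\mathsf{b}\in\mathbb{R}$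 with $\mathsf{a}<0<\mathsf{b}$. The cost functional is $$J(\mathsf{u},\mathsf{z})=\tfrac12\|\mathsf{u}-\mathsf{u}_{\rm d}\|_{L^2(\Omega)}^2+\tfrac{\sigma}{2}\|\mathsf{z}\|_{L^2(\Omega)}^2+\nu\|\mathsf{z}\|_{L^1(\Omega)},$$ and $\mathsf{Z}_{\rm ad}=\{\mathsf{z}\in L^2(\Omega):\mathsf{a}\le\mathsf{z}(x')\le\mathsf{b}\text{ for a.e. }x'\in\Omega\}$. *)

theory Defs
  imports "HOL-Analysis.Analysis"
begin

text \<open>Elements of $L^2(\Omega)$ are represented by functions on the whole space, of which only the
  values on $\Omega$ matter, and equality in $L^2(\Omega)$ is \<open>ae_eq\<close>. The function spaces
  \<open>L2\<close>, \<open>H1\<close>, \<open>H10\<close>, \<open>Hs\<close>, \<open>Zad\<close> are closed under \<open>ae_eq\<close>.\<close>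

definition ae_eq :: "(real^'n) set \<Rightarrow> (real^'n \<Rightarrow> real) \<Rightarrow> (real^'n \<Rightarrow> real) \<Rightarrow> bool" where
  "ae_eq \<Omega> f g \<longleftrightarrow> (AE x in lebesgue_on \<Omega>. f x = g x)"

definition L2 :: "(real^'n) set \<Rightarrow> (real^'n \<Rightarrow> real) set" where
  "L2 \<Omega> = {f. f \<in> borel_measurable (lebesgue_on \<Omega>) \<and> integrable (lebesgue_on \<Omega>) (\<lambda>x. (f x)\<^sup>2)}"

definition L2_inner :: "(real^'n) set \<Rightarrow> (real^'n \<Rightarrow> real) \<Rightarrow> (real^'n \<Rightarrow> real) \<Rightarrow> real" where
  "L2_inner \<Omega> f g = (LINT x|lebesgue_on \<Omega>. f x * g x)"

definition L2_norm :: "(real^'n) set \<Rightarrow> (real^'n \<Rightarrow> real) \<Rightarrow> real" where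
  "L2_norm \<Omega> f = sqrt (LINT x|lebesgue_on \<Omega>. (f x)\<^sup>2)"

definition L1_norm :: "(real^'n) set \<Rightarrow> (real^'n \<Rightarrow> real) \<Rightarrow> real" where
  "L1_norm \<Omega> f = (LINT x|lebesgue_on \<Omega>. \<bar>f x\<bar>)"

definition grad :: "(real^'n \<Rightarrow> real) \<Rightarrow> real^'n \<Rightarrow> real^'n" where
  "grad f x = (\<chi> i. frechet_derivative f (at x) (axis i 1))"

primrec Ck :: "nat \<Rightarrow> (real^'n \<Rightarrow> real) \<Rightarrow> bool" where
  "Ck 0 f \<longleftrightarrow> continuous_on UNIV f"
| "Ck (Suc k) f \<longleftrightarrow> (\<forall>x. f differentiable (at x)) \<and> (\<forall>i. Ck k (\<lambda>x. grad f x $ i))"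

text \<open>$C_c^\infty(\Omega)$, each function being extended by zero outside $\Omega$.\<close>

definition test_functions :: "(real^'n) set \<Rightarrow> (real^'n \<Rightarrow> real) set" where
  "test_functions \<Omega> =
     {\<psi>. (\<forall>k. Ck k \<psi>) \<and> (\<exists>K. compact K \<and> K \<subseteq> \<Omega> \<and> (\<forall>x. x \<notin> K \<longrightarrow> \<psi> x = 0))}"

definition is_weak_grad :: "(real^'n) set \<Rightarrow> (real^'n \<Rightarrow> real) \<Rightarrow> (real^'n \<Rightarrow> real^'n) \<Rightarrow> bool" where
  "is_weak_grad \<Omega> w g \<longleftrightarrow>
     (\<forall>i. (\<lambda>x. g x $ i) \<in> L2 \<Omega>) \<and>
     (\<forall>\<psi>\<in>test_functions \<Omega>. \<forall>i.
        L2_inner \<Omega> w (\<lambda>x. grad \<psi> x $ i) = - L2_inner \<Omega> (\<lambda>x. g x $ i) \<psi>)"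

definition H1 :: "(real^'n) set \<Rightarrow> (real^'n \<Rightarrow> real) set" where
  "H1 \<Omega> = {w \<in> L2 \<Omega>. \<exists>g. is_weak_grad \<Omega> w g}"

text \<open>The choice is harmless: the weak gradient is unique up to null sets.\<close>

definition weak_grad :: "(real^'n) set \<Rightarrow> (real^'n \<Rightarrow> real) \<Rightarrow> real^'n \<Rightarrow> real^'n" where
  "weak_grad \<Omega> w = (SOME g. is_weak_grad \<Omega> w g)"

text \<open>The closure of $C_c^\infty(\Omega)$ in $H^1(\Omega)$.\<close>

definition H10 :: "(real^'n) set \<Rightarrow> (real^'n \<Rightarrow> real) set" where
  "H10 \<Omega> = {w \<in> H1 \<Omega>. \<forall>\<epsilon>>0. \<exists>\<psi>\<in>test_functions \<Omega>.
     sqrt ((L2_norm \<Omega> (\<lambda>x. w x - \<psi> x))\<^sup>2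
         + (L2_norm \<Omega> (\<lambda>x. norm (weak_grad \<Omega> w x - grad \<psi> x)))\<^sup>2) < \<epsilon>}"

text \<open>The bilinear form of $w \mapsto -\mathrm{div}(A\nabla w) + c\,w$.\<close>

definition elliptic_form :: "(real^'n) set \<Rightarrow> (real^'n \<Rightarrow> real^'n^'n) \<Rightarrow> (real^'n \<Rightarrow> real) \<Rightarrow>
    (real^'n \<Rightarrow> real) \<Rightarrow> (real^'n \<Rightarrow> real) \<Rightarrow> real" where
  "elliptic_form \<Omega> A c w v =
     (LINT x|lebesgue_on \<Omega>. (A x *v weak_grad \<Omega> w x) \<bullet> weak_grad \<Omega> v x + c x * w x * v x)"

definition dirichlet_eigenpair :: "(real^'n) set \<Rightarrow> (real^'n \<Rightarrow> real^'n^'n) \<Rightarrow> (real^'n \<Rightarrow> real) \<Rightarrow>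
    real \<Rightarrow> (real^'n \<Rightarrow> real) \<Rightarrow> bool" where
  "dirichlet_eigenpair \<Omega> A c \<mu> w \<longleftrightarrow>
     w \<in> H10 \<Omega> \<and> \<not> ae_eq \<Omega> w (\<lambda>_. 0) \<and>
     (\<forall>v\<in>H10 \<Omega>. elliptic_form \<Omega> A c w v = \<mu> * L2_inner \<Omega> w v)"

definition L2_orthonormal_basis :: "(real^'n) set \<Rightarrow> (nat \<Rightarrow> real^'n \<Rightarrow> real) \<Rightarrow> bool" where
  "L2_orthonormal_basis \<Omega> \<phi> \<longleftrightarrow>
     (\<forall>k. \<phi> k \<in> L2 \<Omega>) \<and>
     (\<forall>j k. L2_inner \<Omega> (\<phi> j) (\<phi> k) = (if j = k then 1 else 0)) \<and>
     (\<forall>w\<in>L2 \<Omega>. (\<lambda>N. L2_norm \<Omega> (\<lambda>x. w x - (\<Sum>k<N. L2_inner \<Omega> w (\<phi> k) * \<phi> k x)))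
        \<longlonglongrightarrow> 0)"

definition Hs :: "(real^'n) set \<Rightarrow> (nat \<Rightarrow> real) \<Rightarrow> (nat \<Rightarrow> real^'n \<Rightarrow> real) \<Rightarrow> real \<Rightarrow>
    (real^'n \<Rightarrow> real) set" where
  "Hs \<Omega> lam \<phi> s =
     {w \<in> L2 \<Omega>. summable (\<lambda>k. lam k powr s * \<bar>L2_inner \<Omega> w (\<phi> k)\<bar>\<^sup>2)}"

text \<open>The series $\mathcal{L}^s w = \sum_k \lambda_k^s w_k \varphi_k$ as an element of the dual of
  \<open>Hs\<close>, applied to \<open>v\<close>; it converges for \<open>w\<close> and \<open>v\<close> in \<open>Hs\<close> by Cauchy--Schwarz. An \<open>L2\<close>
  function \<open>z\<close> is the element \<open>L2_inner \<Omega> z\<close> of this dual.\<close>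

definition frac_op :: "(real^'n) set \<Rightarrow> (nat \<Rightarrow> real) \<Rightarrow> (nat \<Rightarrow> real^'n \<Rightarrow> real) \<Rightarrow> real \<Rightarrow>
    (real^'n \<Rightarrow> real) \<Rightarrow> (real^'n \<Rightarrow> real) \<Rightarrow> real" where
  "frac_op \<Omega> lam \<phi> s w v = (\<Sum>k. lam k powr s * L2_inner \<Omega> w (\<phi> k) * L2_inner \<Omega> (\<phi> k) v)"

definition solves_state_eq :: "(real^'n) set \<Rightarrow> (nat \<Rightarrow> real) \<Rightarrow> (nat \<Rightarrow> real^'n \<Rightarrow> real) \<Rightarrow> real \<Rightarrow>
    (real^'n \<Rightarrow> real) \<Rightarrow> (real^'n \<Rightarrow> real) \<Rightarrow> bool" where
  "solves_state_eq \<Omega> lam \<phi> s z u \<longleftrightarrow>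
     u \<in> Hs \<Omega> lam \<phi> s \<and> (\<forall>v\<in>Hs \<Omega> lam \<phi> s. frac_op \<Omega> lam \<phi> s u v = L2_inner \<Omega> z v)"

text \<open>The graph of the control to state map: \<open>u = S z\<close>, the unique solution of the state
  equation, up to \<open>ae_eq\<close>.\<close>

definition is_state :: "(real^'n) set \<Rightarrow> (nat \<Rightarrow> real) \<Rightarrow> (nat \<Rightarrow> real^'n \<Rightarrow> real) \<Rightarrow> real \<Rightarrow>
    (real^'n \<Rightarrow> real) \<Rightarrow> (real^'n \<Rightarrow> real) \<Rightarrow> bool" where
  "is_state \<Omega> lam \<phi> s z u \<longleftrightarrow>
     solves_state_eq \<Omega> lam \<phi> s z u \<and> (\<forall>u'. solves_state_eq \<Omega> lam \<phi> s z u' \<longrightarrow> ae_eq \<Omega> u' u)"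

definition cost :: "(real^'n) set \<Rightarrow> real \<Rightarrow> real \<Rightarrow> (real^'n \<Rightarrow> real) \<Rightarrow>
    (real^'n \<Rightarrow> real) \<Rightarrow> (real^'n \<Rightarrow> real) \<Rightarrow> real" where
  "cost \<Omega> \<sigma> \<nu> u\<^sub>d u z =
     1/2 * (L2_norm \<Omega> (\<lambda>x. u x - u\<^sub>d x))\<^sup>2 + \<sigma>/2 * (L2_norm \<Omega> z)\<^sup>2 + \<nu> * L1_norm \<Omega> z"

definition Zad :: "(real^'n) set \<Rightarrow> real \<Rightarrow> real \<Rightarrow> (real^'n \<Rightarrow> real) set" where
  "Zad \<Omega> a b = {z \<in> L2 \<Omega>. AE x in lebesgue_on \<Omega>. a \<le> z x \<and> z x \<le> b}"

definition optimal_pair :: "(real^'n) set \<Rightarrow> (nat \<Rightarrow> real) \<Rightarrow> (nat \<Rightarrow> real^'n \<Rightarrow> real) \<Rightarrow> real \<Rightarrow>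
    real \<Rightarrow> real \<Rightarrow> (real^'n \<Rightarrow> real) \<Rightarrow> real \<Rightarrow> real \<Rightarrow>
    (real^'n \<Rightarrow> real) \<Rightarrow> (real^'n \<Rightarrow> real) \<Rightarrow> bool" where
  "optimal_pair \<Omega> lam \<phi> s \<sigma> \<nu> u\<^sub>d a b u z \<longleftrightarrow>
     u \<in> Hs \<Omega> lam \<phi> s \<and> z \<in> Zad \<Omega> a b \<and> is_state \<Omega> lam \<phi> s z u \<and>
     (\<forall>u'\<in>Hs \<Omega> lam \<phi> s. \<forall>z'\<in>Zad \<Omega> a b. is_state \<Omega> lam \<phi> s z' u' \<longrightarrow>
        cost \<Omega> \<sigma> \<nu> u\<^sub>d u z \<le> cost \<Omega> \<sigma> \<nu> u\<^sub>d u' z')"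

end

theory Submission imports Defs begin

text \<open>In terms of coefficients, \<open>u\<close> is the state of \<open>z\<close> iff $\lambda_k^s u_k = z_k$ for all $k$, so
  the admissible pairs form a convex closed subset of $L^2(\Omega) \times L^2(\Omega)$. By the
  parallelogram law, the cost of the midpoint of two pairs lies below the mean of their costs by at least
  $\frac18(\|u-u'\|^2 + \sigma\|z-z'\|^2)$. Hence a minimizing sequence is Cauchy in $L^2$, its limit
  is a minimizer by continuity of the cost, and any two minimizers coincide.\<close>

lemma L2_measurable [measurable_dest]: "f \<in> L2 \<Omega> \<Longrightarrow> f \<in> borel_measurable (lebesgue_on \<Omega>)"
  by (simp add: L2_def)

lemma L2_square_integrable: "f \<in> L2 \<Omega> \<Longrightarrow> integrable (lebesgue_on \<Omega>) (\<lambda>x. (f x)\<^sup>2)"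
  by (simp add: L2_def)

lemma L2_mult_integrable:
  assumes "f \<in> L2 \<Omega>" "g \<in> L2 \<Omega>"
  shows "integrable (lebesgue_on \<Omega>) (\<lambda>x. f x * g x)"
proof (rule Bochner_Integration.integrable_bound)
  show "integrable (lebesgue_on \<Omega>) (\<lambda>x. (f x)\<^sup>2 + (g x)\<^sup>2)"
    using assms by (simp add: L2_square_integrable)
  show "(\<lambda>x. f x * g x) \<in> borel_measurable (lebesgue_on \<Omega>)"
    using assms[THEN L2_measurable] by measurable
  have "norm (f x * g x) \<le> norm ((f x)\<^sup>2 + (g x)\<^sup>2)" for x
  proof -
    have "0 \<le> (\<bar>f x\<bar> - \<bar>g x\<bar>)\<^sup>2" by simp
    then have "2 * (\<bar>f x\<bar> * \<bar>g x\<bar>) \<le> (f x)\<^sup>2 + (g x)\<^sup>2"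
      by (simp add: power2_diff)
    moreover have "0 \<le> \<bar>f x\<bar> * \<bar>g x\<bar>" by simp
    ultimately have "\<bar>f x * g x\<bar> \<le> (f x)\<^sup>2 + (g x)\<^sup>2" unfolding abs_mult by linarith
    then show ?thesis by simp
  qed
  then show "AE x in lebesgue_on \<Omega>. norm (f x * g x) \<le> norm ((f x)\<^sup>2 + (g x)\<^sup>2)"
    by simp
qed

lemma L2_cmult: "f \<in> L2 \<Omega> \<Longrightarrow> (\<lambda>x. c * f x) \<in> L2 \<Omega>"
  by (auto simp: L2_def power_mult_distrib)

lemma L2_add:
  assumes "f \<in> L2 \<Omega>" "g \<in> L2 \<Omega>"
  shows "(\<lambda>x. f x + g x) \<in> L2 \<Omega>"
  using assms L2_mult_integrable[OF assms]
  by (auto simp: L2_def power2_sum mult.assoc)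

lemma L2_diff: "f \<in> L2 \<Omega> \<Longrightarrow> g \<in> L2 \<Omega> \<Longrightarrow> (\<lambda>x. f x - g x) \<in> L2 \<Omega>"
  using L2_add[of f \<Omega> "\<lambda>x. - 1 * g x"] L2_cmult[of g \<Omega> "- 1"] by simp

lemma L2_zero: "(\<lambda>x. 0) \<in> L2 \<Omega>"
  by (simp add: L2_def)

lemma L2_sum: "(\<And>i. i \<in> I \<Longrightarrow> f i \<in> L2 \<Omega>) \<Longrightarrow> (\<lambda>x. \<Sum>i\<in>I. f i x) \<in> L2 \<Omega>"
  by (induction I rule: infinite_finite_induct) (auto simp: L2_zero intro!: L2_add)

lemma L2_abs: "f \<in> L2 \<Omega> \<Longrightarrow> (\<lambda>x. \<bar>f x\<bar>) \<in> L2 \<Omega>"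
  by (auto simp: L2_def)

lemmas L2_intros = L2_cmult L2_add L2_diff L2_zero L2_sum L2_abs

lemma L2_inner_commute: "L2_inner \<Omega> f g = L2_inner \<Omega> g f"
  by (simp add: L2_inner_def mult.commute)

text \<open>Scaling, unlike addition, holds for all functions: if \<open>f x * g x\<close> is not
  integrable, both sides take the default value 0.\<close>

lemma L2_inner_cmult_left: "L2_inner \<Omega> (\<lambda>x. c * f x) g = c * L2_inner \<Omega> f g"
  by (simp add: L2_inner_def mult.assoc)

lemma L2_inner_add_left:
  "f \<in> L2 \<Omega> \<Longrightarrow> g \<in> L2 \<Omega> \<Longrightarrow> h \<in> L2 \<Omega> \<Longrightarrow>
    L2_inner \<Omega> (\<lambda>x. f x + g x) h = L2_inner \<Omega> f h + L2_inner \<Omega> g h"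
  by (simp add: L2_inner_def distrib_right L2_mult_integrable)

lemma L2_inner_diff_left:
  "f \<in> L2 \<Omega> \<Longrightarrow> g \<in> L2 \<Omega> \<Longrightarrow> h \<in> L2 \<Omega> \<Longrightarrow>
    L2_inner \<Omega> (\<lambda>x. f x - g x) h = L2_inner \<Omega> f h - L2_inner \<Omega> g h"
  by (simp add: L2_inner_def left_diff_distrib L2_mult_integrable)

lemma L2_inner_sum_left:
  "(\<And>i. i \<in> I \<Longrightarrow> f i \<in> L2 \<Omega>) \<Longrightarrow> h \<in> L2 \<Omega> \<Longrightarrow>
    L2_inner \<Omega> (\<lambda>x. \<Sum>i\<in>I. f i x) h = (\<Sum>i\<in>I. L2_inner \<Omega> (f i) h)"
  by (simp add: L2_inner_def sum_distrib_right L2_mult_integrable)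

lemma L2_norm_nonneg: "0 \<le> L2_norm \<Omega> f"
  by (simp add: L2_norm_def)

lemma L2_norm_sq: "(L2_norm \<Omega> f)\<^sup>2 = L2_inner \<Omega> f f"
  by (simp add: L2_norm_def L2_inner_def power2_eq_square)

lemma L2_norm_diff_commute: "L2_norm \<Omega> (\<lambda>x. f x - g x) = L2_norm \<Omega> (\<lambda>x. g x - f x)"
  by (simp add: L2_norm_def power2_commute)

lemma L2_norm_add_sq:
  assumes f: "f \<in> L2 \<Omega>" and g: "g \<in> L2 \<Omega>"
  shows "(L2_norm \<Omega> (\<lambda>x. f x + g x))\<^sup>2 =
    (L2_norm \<Omega> f)\<^sup>2 + 2 * L2_inner \<Omega> f g + (L2_norm \<Omega> g)\<^sup>2"
proof -
  have "L2_inner \<Omega> f (\<lambda>x. f x + g x) = L2_inner \<Omega> f f + L2_inner \<Omega> f g"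
    and "L2_inner \<Omega> g (\<lambda>x. f x + g x) = L2_inner \<Omega> f g + L2_inner \<Omega> g g"
    using L2_inner_add_left[OF f g f] L2_inner_add_left[OF f g g]
    by (simp_all add: L2_inner_commute)
  then show ?thesis
    using L2_inner_add_left[OF f g L2_add[OF f g]] by (simp add: L2_norm_sq)
qed

lemma L2_norm_cmult_sq: "(L2_norm \<Omega> (\<lambda>x. c * f x))\<^sup>2 = c\<^sup>2 * (L2_norm \<Omega> f)\<^sup>2"
  unfolding L2_norm_sq L2_inner_cmult_left L2_inner_commute[of \<Omega> f "\<lambda>x. c * f x"]
  by (simp add: power2_eq_square)

lemma L2_norm_diff_sq:
  assumes f: "f \<in> L2 \<Omega>" and g: "g \<in> L2 \<Omega>"
  shows "(L2_norm \<Omega> (\<lambda>x. f x - g x))\<^sup>2 =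
    (L2_norm \<Omega> f)\<^sup>2 - 2 * L2_inner \<Omega> f g + (L2_norm \<Omega> g)\<^sup>2"
  using L2_norm_add_sq[OF f L2_cmult[OF g, of "- 1"]] L2_norm_cmult_sq[of \<Omega> "- 1" g]
    L2_inner_cmult_left[of \<Omega> "- 1" g f]
  by (simp add: L2_inner_commute[of \<Omega> f])

text \<open>The parallelogram law, solved for the midpoint. The subtracted quarter is the
  quantitative form of strict convexity.\<close>

lemma L2_norm_midpoint_sq:
  assumes f: "f \<in> L2 \<Omega>" and g: "g \<in> L2 \<Omega>"
  shows "(L2_norm \<Omega> (\<lambda>x. 1/2 * (f x + g x)))\<^sup>2 =
    ((L2_norm \<Omega> f)\<^sup>2 + (L2_norm \<Omega> g)\<^sup>2) / 2 - (L2_norm \<Omega> (\<lambda>x. f x - g x))\<^sup>2 / 4"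
  unfolding L2_norm_cmult_sq L2_norm_add_sq[OF f g] L2_norm_diff_sq[OF f g]
  by (simp add: power2_eq_square field_simps)

lemma L2_Cauchy_Schwarz:
  assumes f: "f \<in> L2 \<Omega>" and g: "g \<in> L2 \<Omega>"
  shows "\<bar>L2_inner \<Omega> f g\<bar> \<le> L2_norm \<Omega> f * L2_norm \<Omega> g"
proof -
  define F G B where "F = (L2_norm \<Omega> f)\<^sup>2" and "G = (L2_norm \<Omega> g)\<^sup>2" and "B = L2_inner \<Omega> f g"
  have pos: "0 \<le> F - 2 * t * B + t\<^sup>2 * G" for t
    using L2_norm_diff_sq[OF f L2_cmult[OF g, of t]] L2_inner_cmult_left[of \<Omega> t g f]
      zero_le_power2[of "L2_norm \<Omega> (\<lambda>x. f x - t * g x)"]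
    by (simp add: L2_norm_cmult_sq F_def G_def B_def L2_inner_commute[of \<Omega> f] mult_ac)
  have "B\<^sup>2 \<le> F * G"
  proof (cases "G = 0")
    case True
    have "B = 0"
    proof (rule ccontr)
      assume "B \<noteq> 0"
      \<comment> \<open>For \<open>G = 0\<close> the polynomial is affine in \<open>t\<close>, and
        this choice of \<open>t\<close> gives it the value -1.\<close>
      then show False using pos[of "(F + 1) / (2 * B)"] True by (simp add: field_simps)
    qed
    then show ?thesis using True by simp
  next
    case False
    then have "G > 0" by (simp add: G_def)
    \<comment> \<open>The value at the minimizer \<open>t = B / G\<close>.\<close>
    have "0 \<le> F - B\<^sup>2 / G"
      using pos[of "B / G"] False by (simp add: power2_eq_square field_simps)
    then show ?thesis using \<open>G > 0\<close> by (simp add: field_simps)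
  qed
  then have "\<bar>B\<bar>\<^sup>2 \<le> (L2_norm \<Omega> f * L2_norm \<Omega> g)\<^sup>2"
    by (simp add: F_def G_def power_mult_distrib)
  then show ?thesis
    unfolding B_def by (rule power2_le_imp_le) (simp add: L2_norm_nonneg)
qed

lemma L2_norm_eq_0_iff:
  assumes "f \<in> L2 \<Omega>"
  shows "L2_norm \<Omega> f = 0 \<longleftrightarrow> (AE x in lebesgue_on \<Omega>. f x = 0)"
  using integral_nonneg_eq_0_iff_AE[OF L2_square_integrable[OF assms]] by (simp add: L2_norm_def)

section \<open>Continuity of the inner product and of the $L^2$ and $L^1$ norms\<close>

lemma L2_inner_tendsto:
  assumes "\<And>n. f n \<in> L2 \<Omega>" "g \<in> L2 \<Omega>" "h \<in> L2 \<Omega>"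
    and lim: "(\<lambda>n. L2_norm \<Omega> (\<lambda>x. f n x - g x)) \<longlonglongrightarrow> 0"
  shows "(\<lambda>n. L2_inner \<Omega> (f n) h) \<longlonglongrightarrow> L2_inner \<Omega> g h"
proof -
  have "(\<lambda>n. L2_inner \<Omega> (f n) h - L2_inner \<Omega> g h) \<longlonglongrightarrow> 0"
  proof (rule Lim_null_comparison)
    \<comment> \<open>Cauchy-Schwarz for \<open>f n - g\<close> and \<open>h\<close>: norm
      convergence implies weak convergence.\<close>
    show "\<forall>\<^sub>F n in sequentially. norm (L2_inner \<Omega> (f n) h - L2_inner \<Omega> g h)
        \<le> L2_norm \<Omega> (\<lambda>x. f n x - g x) * L2_norm \<Omega> h"
      using assms L2_Cauchy_Schwarz[OF L2_diff[OF assms(1,2)] assms(3)]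
      by (simp add: L2_inner_diff_left)
    show "(\<lambda>n. L2_norm \<Omega> (\<lambda>x. f n x - g x) * L2_norm \<Omega> h) \<longlonglongrightarrow> 0"
      using tendsto_mult_right[OF lim] by simp
  qed
  then show ?thesis by (simp add: LIM_zero_iff)
qed

lemma L2_norm_sq_tendsto:
  assumes f: "\<And>n. f n \<in> L2 \<Omega>" and g: "g \<in> L2 \<Omega>"
    and lim: "(\<lambda>n. L2_norm \<Omega> (\<lambda>x. f n x - g x)) \<longlonglongrightarrow> 0"
  shows "(\<lambda>n. (L2_norm \<Omega> (f n))\<^sup>2) \<longlonglongrightarrow> (L2_norm \<Omega> g)\<^sup>2"
proof -
  \<comment> \<open>Expanding the square of \<open>f n - g\<close> leaves only a norm that tends to
    0 and an inner product with the fixed function \<open>g\<close>.\<close>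
  have "(L2_norm \<Omega> (f n))\<^sup>2 = (L2_norm \<Omega> (\<lambda>x. f n x - g x))\<^sup>2
      + 2 * L2_inner \<Omega> (f n) g - (L2_norm \<Omega> g)\<^sup>2" for n
    using L2_norm_diff_sq[OF f[of n] g] by simp
  moreover have "(\<lambda>n. (L2_norm \<Omega> (\<lambda>x. f n x - g x))\<^sup>2 + 2 * L2_inner \<Omega> (f n) g - (L2_norm \<Omega> g)\<^sup>2)
      \<longlonglongrightarrow> 0\<^sup>2 + 2 * L2_inner \<Omega> g g - (L2_norm \<Omega> g)\<^sup>2"
    by (intro tendsto_intros lim L2_inner_tendsto f g)
  ultimately show ?thesis by (simp add: L2_norm_sq)
qed

lemma L2_const:
  assumes "finite_measure (lebesgue_on \<Omega>)"
  shows "(\<lambda>x. c) \<in> L2 \<Omega>"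
  using finite_measure.integrable_const[OF assms] by (simp add: L2_def)

lemma L2_integrable:
  assumes "finite_measure (lebesgue_on \<Omega>)" "f \<in> L2 \<Omega>"
  shows "integrable (lebesgue_on \<Omega>) f"
  using L2_mult_integrable[OF assms(2) L2_const[OF assms(1), of 1]] by simp

text \<open>Cauchy-Schwarz for \<open>\<bar>f x\<bar>\<close> and the constant 1, which is in
  \<open>L2\<close> because the measure is finite.\<close>

lemma L1_norm_le_L2_norm:
  assumes "finite_measure (lebesgue_on \<Omega>)" "f \<in> L2 \<Omega>"
  shows "L1_norm \<Omega> f \<le> L2_norm \<Omega> f * L2_norm \<Omega> (\<lambda>x. 1)"
  using L2_Cauchy_Schwarz[OF L2_abs[OF assms(2)] L2_const[OF assms(1), of 1]]
  by (simp add: L1_norm_def L2_inner_def L2_norm_def)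

lemma L1_norm_tendsto:
  assumes fin: "finite_measure (lebesgue_on \<Omega>)"
    and f: "\<And>n. f n \<in> L2 \<Omega>" and g: "g \<in> L2 \<Omega>"
    and lim: "(\<lambda>n. L2_norm \<Omega> (\<lambda>x. f n x - g x)) \<longlonglongrightarrow> 0"
  shows "(\<lambda>n. L1_norm \<Omega> (f n)) \<longlonglongrightarrow> L1_norm \<Omega> g"
proof -
  have "(\<lambda>n. L1_norm \<Omega> (f n) - L1_norm \<Omega> g) \<longlonglongrightarrow> 0"
  proof (rule Lim_null_comparison)
    \<comment> \<open>The reverse triangle inequality, integrated.\<close>
    have "norm (L1_norm \<Omega> (f n) - L1_norm \<Omega> g) \<le> L1_norm \<Omega> (\<lambda>x. f n x - g x)" for n
    proof -
      have "L1_norm \<Omega> (f n) - L1_norm \<Omega> g = (LINT x|lebesgue_on \<Omega>. \<bar>f n x\<bar> - \<bar>g x\<bar>)"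
        unfolding L1_norm_def using L2_integrable[OF fin f] L2_integrable[OF fin g] by simp
      also have "norm \<dots> \<le> (LINT x|lebesgue_on \<Omega>. norm (\<bar>f n x\<bar> - \<bar>g x\<bar>))"
        by (rule integral_norm_bound)
      also have "\<dots> \<le> L1_norm \<Omega> (\<lambda>x. f n x - g x)"
        unfolding L1_norm_def using L2_integrable[OF fin f] L2_integrable[OF fin g]
        by (intro integral_mono) auto
      finally show ?thesis .
    qed
    then show "\<forall>\<^sub>F n in sequentially. norm (L1_norm \<Omega> (f n) - L1_norm \<Omega> g)
        \<le> L2_norm \<Omega> (\<lambda>x. f n x - g x) * L2_norm \<Omega> (\<lambda>x. 1)"
      by (intro always_eventually allI order_trans[OF _ L1_norm_le_L2_norm[OF fin L2_diff[OF f g]]])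
    show "(\<lambda>n. L2_norm \<Omega> (\<lambda>x. f n x - g x) * L2_norm \<Omega> (\<lambda>x. 1)) \<longlonglongrightarrow> 0"
      using tendsto_mult_right[OF lim] by simp
  qed
  then show ?thesis by (simp add: LIM_zero_iff)
qed

lemma L1_norm_midpoint_le:
  assumes "finite_measure (lebesgue_on \<Omega>)" "f \<in> L2 \<Omega>" "g \<in> L2 \<Omega>"
  shows "L1_norm \<Omega> (\<lambda>x. 1/2 * (f x + g x)) \<le> (L1_norm \<Omega> f + L1_norm \<Omega> g) / 2"
proof -
  note [simp] = L2_integrable[OF assms(1,2)] L2_integrable[OF assms(1,3)]
  have "L1_norm \<Omega> (\<lambda>x. 1/2 * (f x + g x)) \<le> (LINT x|lebesgue_on \<Omega>. (\<bar>f x\<bar> + \<bar>g x\<bar>) / 2)"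
    unfolding L1_norm_def
  proof (rule integral_mono)
    show "\<bar>1/2 * (f x + g x)\<bar> \<le> (\<bar>f x\<bar> + \<bar>g x\<bar>) / 2" for x
      using abs_triangle_ineq[of "f x" "g x"] by (simp add: abs_mult)
  qed simp_all
  also have "\<dots> = (L1_norm \<Omega> f + L1_norm \<Omega> g) / 2"
    by (simp add: L1_norm_def)
  finally show ?thesis .
qed

lemma L2_tendsto_AE_subseq:
  assumes "\<And>n. f n \<in> L2 \<Omega>" "g \<in> L2 \<Omega>"
    and lim: "(\<lambda>n. L2_norm \<Omega> (\<lambda>x. f n x - g x)) \<longlonglongrightarrow> 0"
  obtains r where "strict_mono r" "AE x in lebesgue_on \<Omega>. (\<lambda>n. f (r n) x) \<longlonglongrightarrow> g x"
proof -
  \<comment> \<open>The squares of \<open>f n - g\<close> tend to 0 in $L^1$, hence almost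
    everywhere along a subsequence. Square roots then give the pointwise limit of
    \<open>f (r n)\<close>.\<close>
  have "(\<lambda>n. (L2_norm \<Omega> (\<lambda>x. f n x - g x))\<^sup>2) \<longlonglongrightarrow> 0\<^sup>2"
    by (intro tendsto_intros lim)
  then have "(\<lambda>n. LINT x|lebesgue_on \<Omega>. norm ((f n x - g x)\<^sup>2)) \<longlonglongrightarrow> 0"
    by (simp add: L2_norm_def)
  from tendsto_L1_AE_subseq[OF L2_square_integrable[OF L2_diff] this] assms
  obtain r :: "nat \<Rightarrow> nat" where "strict_mono r"
    and *: "AE x in lebesgue_on \<Omega>. (\<lambda>n. (f (r n) x - g x)\<^sup>2) \<longlonglongrightarrow> 0"
    by blast
  have **: "(\<lambda>n. f (r n) x) \<longlonglongrightarrow> g x" if "(\<lambda>n. (f (r n) x - g x)\<^sup>2) \<longlonglongrightarrow> 0" for x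
    using tendsto_real_sqrt[OF that] by (simp add: tendsto_rabs_zero_iff LIM_zero_iff)
  from * have "AE x in lebesgue_on \<Omega>. (\<lambda>n. f (r n) x) \<longlonglongrightarrow> g x"
    by eventually_elim (rule **)
  with \<open>strict_mono r\<close> show thesis by (rule that)
qed

text \<open>The Riesz-Fischer argument. On a finite measure space the sequence is also Cauchy in
  $L^1$, so a subsequence converges almost everywhere. Fatou's lemma carries the $L^2$ estimates
  over to the pointwise limit.\<close>

lemma L2_complete:
  assumes fin: "finite_measure (lebesgue_on \<Omega>)" and f: "\<And>n. f n \<in> L2 \<Omega>"
    and cauchy: "\<And>e. e > 0 \<Longrightarrow> \<exists>N. \<forall>m\<ge>N. \<forall>n\<ge>N. L2_norm \<Omega> (\<lambda>x. f m x - f n x) < e"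
  obtains g where "g \<in> L2 \<Omega>" "(\<lambda>n. L2_norm \<Omega> (\<lambda>x. f n x - g x)) \<longlonglongrightarrow> 0"
proof -
  let ?M = "lebesgue_on \<Omega>"
  note [measurable] = L2_measurable[OF f]
  have L1_cauchy: "\<exists>N. \<forall>m\<ge>N. \<forall>n\<ge>N. (LINT x|?M. norm (f m x - f n x)) < e" if "e > 0" for e
  proof -
    let ?C = "L2_norm \<Omega> (\<lambda>x. 1)"
    \<comment> \<open>The added 1 keeps the denominator positive even if \<open>?C\<close> is
      0.\<close>
    have "0 < e / (?C + 1)"
      using that L2_norm_nonneg[of \<Omega> "\<lambda>x. 1"] by simp
    from cauchy[OF this] obtain N
      where N: "\<And>m n. m \<ge> N \<Longrightarrow> n \<ge> N \<Longrightarrow> L2_norm \<Omega> (\<lambda>x. f m x - f n x) < e / (?C + 1)"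
      by blast
    have "(LINT x|?M. norm (f m x - f n x)) < e" if "m \<ge> N" "n \<ge> N" for m n
    proof -
      have "(LINT x|?M. norm (f m x - f n x)) \<le> L2_norm \<Omega> (\<lambda>x. f m x - f n x) * ?C"
        using L1_norm_le_L2_norm[OF fin L2_diff[OF f f]] by (simp add: L1_norm_def)
      also have "\<dots> \<le> L2_norm \<Omega> (\<lambda>x. f m x - f n x) * (?C + 1)"
        by (intro mult_left_mono) (auto simp: L2_norm_nonneg)
      also have "\<dots> < e"
        using N[OF that] L2_norm_nonneg[of \<Omega> "\<lambda>x. 1"] by (simp add: field_simps)
      finally show ?thesis .
    qed
    then show ?thesis by blast
  qed
  obtain r where r: "strict_mono r" and AE_cauchy: "AE x in ?M. Cauchy (\<lambda>i. f (r i) x)"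
    using cauchy_L1_AE_cauchy_subseq[of ?M f, OF L2_integrable[OF fin f] L1_cauchy] by blast
  \<comment> \<open>Where the subsequence diverges, \<open>lim\<close> is one fixed unspecified
    value. Such points form a null set.\<close>
  define g where "g x = lim (\<lambda>i. f (r i) x)" for x
  have [measurable]: "g \<in> borel_measurable ?M"
    unfolding g_def by measurable
  have AE_lim: "AE x in ?M. (\<lambda>i. f (r i) x) \<longlonglongrightarrow> g x"
    using AE_cauchy by (rule AE_mp) (simp add: g_def Cauchy_convergent_iff convergent_LIMSEQ_iff)
  \<comment> \<open>The integral is taken in \<open>ennreal\<close> because square integrability of
    \<open>f n - g\<close> is not yet known. The limit inferior runs over \<open>r i\<close> with
    \<open>n\<close> fixed, and the bound applies from \<open>i \<ge> N\<close> on because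
    \<open>i \<le> r i\<close>.\<close>
  have fatou: "(\<integral>\<^sup>+x. ennreal ((f n x - g x)\<^sup>2) \<partial>?M) \<le> ennreal (e\<^sup>2)"
    if "e > 0" and N: "\<And>m. m \<ge> N \<Longrightarrow> L2_norm \<Omega> (\<lambda>x. f n x - f m x) < e" for n N e
  proof -
    have "(\<integral>\<^sup>+x. ennreal ((f n x - g x)\<^sup>2) \<partial>?M) =
        (\<integral>\<^sup>+x. liminf (\<lambda>i. ennreal ((f n x - f (r i) x)\<^sup>2)) \<partial>?M)"
    proof (rule nn_integral_cong_AE, rule AE_mp[OF AE_lim], rule AE_I2, rule impI)
      fix x assume "(\<lambda>i. f (r i) x) \<longlonglongrightarrow> g x"
      then have "(\<lambda>i. ennreal ((f n x - f (r i) x)\<^sup>2)) \<longlonglongrightarrow> ennreal ((f n x - g x)\<^sup>2)"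
        by (intro tendsto_intros)
      then show "ennreal ((f n x - g x)\<^sup>2) = liminf (\<lambda>i. ennreal ((f n x - f (r i) x)\<^sup>2))"
        by (intro lim_imp_Liminf[symmetric] trivial_limit_sequentially)
    qed
    also have "\<dots> \<le> liminf (\<lambda>i. \<integral>\<^sup>+x. ennreal ((f n x - f (r i) x)\<^sup>2) \<partial>?M)"
      by (rule nn_integral_liminf) measurable
    also have "\<dots> \<le> liminf (\<lambda>i. ennreal (e\<^sup>2))"
    proof (rule Liminf_mono, rule eventually_sequentiallyI)
      fix i assume "N \<le> i"
      then have "L2_norm \<Omega> (\<lambda>x. f n x - f (r i) x) < e"
        using N[of "r i"] seq_suble[OF r, of i] by simp
      then have "(L2_norm \<Omega> (\<lambda>x. f n x - f (r i) x))\<^sup>2 \<le> e\<^sup>2"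
        using L2_norm_nonneg by (intro power_mono) auto
      then show "(\<integral>\<^sup>+x. ennreal ((f n x - f (r i) x)\<^sup>2) \<partial>?M) \<le> ennreal (e\<^sup>2)"
        using nn_integral_eq_integral[OF L2_square_integrable[OF L2_diff[OF f f]]]
        by (simp add: L2_norm_def ennreal_leI)
    qed
    also have "\<dots> = ennreal (e\<^sup>2)" by (simp add: Liminf_const)
    finally show ?thesis .
  qed
  have diff: "(\<lambda>x. f n x - g x) \<in> L2 \<Omega> \<and> L2_norm \<Omega> (\<lambda>x. f n x - g x) \<le> e"
    if "e > 0" and N: "\<And>m. m \<ge> N \<Longrightarrow> L2_norm \<Omega> (\<lambda>x. f n x - f m x) < e" for n N e
  proof -
    have le: "(\<integral>\<^sup>+x. ennreal ((f n x - g x)\<^sup>2) \<partial>?M) \<le> ennreal (e\<^sup>2)"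
      by (rule fatou[OF that])
    also have "\<dots> < \<infinity>" by simp
    finally have int: "integrable ?M (\<lambda>x. (f n x - g x)\<^sup>2)"
      by (intro integrableI_nonneg) auto
    have "(LINT x|?M. (f n x - g x)\<^sup>2) \<le> e\<^sup>2"
      using le nn_integral_eq_integral[OF int] by simp
    then show ?thesis
      using int \<open>e > 0\<close> by (auto simp: L2_def L2_norm_def intro: real_le_lsqrt)
  qed
  have ex: "\<exists>N. \<forall>n\<ge>N. (\<lambda>x. f n x - g x) \<in> L2 \<Omega> \<and> L2_norm \<Omega> (\<lambda>x. f n x - g x) \<le> e"
    if "e > 0" for e
    using cauchy[OF that] diff[OF that] by blast
  obtain n where "(\<lambda>x. f n x - g x) \<in> L2 \<Omega>"
    using ex[of 1] by auto
  \<comment> \<open>\<open>g\<close> is the difference of \<open>f n\<close> and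
    \<open>f n - g\<close>.\<close>
  from L2_diff[OF f[of n] this] have "g \<in> L2 \<Omega>" by simp
  moreover have "(\<lambda>n. L2_norm \<Omega> (\<lambda>x. f n x - g x)) \<longlonglongrightarrow> 0"
  proof (rule LIMSEQ_I)
    fix e :: real assume "e > 0"
    then obtain N where "\<And>n. n \<ge> N \<Longrightarrow> L2_norm \<Omega> (\<lambda>x. f n x - g x) \<le> e / 2"
      using ex[of "e / 2"] by auto
    with \<open>e > 0\<close> show "\<exists>N. \<forall>n\<ge>N. norm (L2_norm \<Omega> (\<lambda>x. f n x - g x) - 0) < e"
      by (intro exI[of _ N]) (force simp: L2_norm_nonneg)
  qed
  ultimately show thesis by (rule that)
qed

section \<open>Fourier coefficients and the state equation\<close>

lemma L2_Parseval:
  assumes onb: "L2_orthonormal_basis \<Omega> \<phi>" and w: "w \<in> L2 \<Omega>" and v: "v \<in> L2 \<Omega>"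
  shows "(\<lambda>k. L2_inner \<Omega> w (\<phi> k) * L2_inner \<Omega> (\<phi> k) v) sums L2_inner \<Omega> w v"
proof -
  have \<phi>: "\<phi> k \<in> L2 \<Omega>" for k using onb by (simp add: L2_orthonormal_basis_def)
  define p where "p N x = (\<Sum>k<N. L2_inner \<Omega> w (\<phi> k) * \<phi> k x)" for N x
  have p: "p N \<in> L2 \<Omega>" for N unfolding p_def by (intro L2_intros \<phi>)
  \<comment> \<open>The partial sums of the expansion converge to \<open>w\<close> in norm, so their
    inner products with \<open>v\<close> converge as well.\<close>
  have "(\<lambda>N. L2_norm \<Omega> (\<lambda>x. p N x - w x)) \<longlonglongrightarrow> 0"
    unfolding L2_norm_diff_commute[of \<Omega> "p _" w]
    using onb w by (simp add: L2_orthonormal_basis_def p_def)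
  from L2_inner_tendsto[OF p w v this] have "(\<lambda>N. L2_inner \<Omega> (p N) v) \<longlonglongrightarrow> L2_inner \<Omega> w v" .
  moreover have "L2_inner \<Omega> (p N) v = (\<Sum>k<N. L2_inner \<Omega> w (\<phi> k) * L2_inner \<Omega> (\<phi> k) v)" for N
    unfolding p_def by (simp add: L2_inner_sum_left L2_cmult \<phi> v L2_inner_cmult_left)
  ultimately show ?thesis by (simp add: sums_def)
qed

text \<open>The difference has only zero coefficients, so Parseval's identity gives it norm
  0.\<close>

lemma L2_eq_of_coeffs:
  assumes onb: "L2_orthonormal_basis \<Omega> \<phi>" and w: "w \<in> L2 \<Omega>" and v: "v \<in> L2 \<Omega>"
    and eq: "\<And>k. L2_inner \<Omega> w (\<phi> k) = L2_inner \<Omega> v (\<phi> k)"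
  shows "ae_eq \<Omega> w v"
proof -
  let ?d = "\<lambda>x. w x - v x"
  have "L2_inner \<Omega> ?d (\<phi> k) = 0" for k
    using onb eq by (simp add: L2_inner_diff_left w v L2_orthonormal_basis_def)
  with L2_Parseval[OF onb L2_diff[OF w v] L2_diff[OF w v]]
  have "(\<lambda>k. 0) sums (L2_norm \<Omega> ?d)\<^sup>2"
    by (simp add: L2_norm_sq)
  then have "(L2_norm \<Omega> ?d)\<^sup>2 = 0"
    using sums_zero by (rule sums_unique2)
  then show ?thesis
    using L2_norm_eq_0_iff[OF L2_diff[OF w v]] by (simp add: ae_eq_def)
qed

text \<open>Testing with \<open>\<phi> k\<close> isolates the \<open>k\<close>-th equation.
  Conversely, the coefficient equations turn the series of \<open>frac_op\<close> into the Parseval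
  series of \<open>L2_inner \<Omega> z v\<close>.\<close>

lemma solves_state_eq_iff_coeffs:
  assumes onb: "L2_orthonormal_basis \<Omega> \<phi>" and z: "z \<in> L2 \<Omega>"
  shows "solves_state_eq \<Omega> lam \<phi> s z u \<longleftrightarrow>
    u \<in> L2 \<Omega> \<and> (\<forall>k. lam k powr s * L2_inner \<Omega> u (\<phi> k) = L2_inner \<Omega> z (\<phi> k))"
proof
  have \<phi>: "\<phi> k \<in> L2 \<Omega>" and ortho: "L2_inner \<Omega> (\<phi> j) (\<phi> k) = (if j = k then 1 else 0)" for j k
    using onb by (simp_all add: L2_orthonormal_basis_def)
  {
    assume sol: "solves_state_eq \<Omega> lam \<phi> s z u"
    have "lam k powr s * L2_inner \<Omega> u (\<phi> k) = L2_inner \<Omega> z (\<phi> k)" for k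
    proof -
      \<comment> \<open>By orthonormality only the \<open>k\<close>-th term of the defining series
        is nonzero.\<close>
      have "\<phi> k \<in> Hs \<Omega> lam \<phi> s"
        unfolding Hs_def using \<phi> by (auto simp: ortho intro!: summable_finite[of "{k}"] split: if_splits)
      with sol have "frac_op \<Omega> lam \<phi> s u (\<phi> k) = L2_inner \<Omega> z (\<phi> k)"
        by (simp add: solves_state_eq_def)
      moreover have "frac_op \<Omega> lam \<phi> s u (\<phi> k) = lam k powr s * L2_inner \<Omega> u (\<phi> k)"
        unfolding frac_op_def by (subst suminf_finite[of "{k}"]) (auto simp: ortho)
      ultimately show ?thesis by simp
    qed
    then show "u \<in> L2 \<Omega> \<and> (\<forall>k. lam k powr s * L2_inner \<Omega> u (\<phi> k) = L2_inner \<Omega> z (\<phi> k))"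
      using sol by (auto simp: solves_state_eq_def Hs_def)
  next
    assume R: "u \<in> L2 \<Omega> \<and> (\<forall>k. lam k powr s * L2_inner \<Omega> u (\<phi> k) = L2_inner \<Omega> z (\<phi> k))"
    have "(\<lambda>k. lam k powr s * \<bar>L2_inner \<Omega> u (\<phi> k)\<bar>\<^sup>2) =
        (\<lambda>k. L2_inner \<Omega> z (\<phi> k) * L2_inner \<Omega> (\<phi> k) u)"
      using R by (auto simp: power2_eq_square mult.assoc[symmetric] L2_inner_commute[of \<Omega> "\<phi> _" u])
    then have "u \<in> Hs \<Omega> lam \<phi> s"
      using R L2_Parseval[OF onb z, of u] by (simp add: Hs_def sums_iff)
    moreover have "frac_op \<Omega> lam \<phi> s u v = L2_inner \<Omega> z v" if "v \<in> L2 \<Omega>" for v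
      using R L2_Parseval[OF onb z that] by (simp add: frac_op_def sums_iff)
    ultimately show "solves_state_eq \<Omega> lam \<phi> s z u"
      by (auto simp: solves_state_eq_def Hs_def)
  }
qed

text \<open>Since \<open>lam k powr s\<close> is positive, the equations determine every coefficient
  of \<open>u\<close>. Solutions are therefore unique up to \<open>ae_eq\<close>, and solving the
  equation already means being the state.\<close>

lemma is_state_iff_coeffs:
  assumes onb: "L2_orthonormal_basis \<Omega> \<phi>" and lam: "\<And>k. 0 < lam k" and z: "z \<in> L2 \<Omega>"
  shows "is_state \<Omega> lam \<phi> s z u \<longleftrightarrow>
    u \<in> L2 \<Omega> \<and> (\<forall>k. lam k powr s * L2_inner \<Omega> u (\<phi> k) = L2_inner \<Omega> z (\<phi> k))"
proof -
  have "ae_eq \<Omega> u' u" if "solves_state_eq \<Omega> lam \<phi> s z u" "solves_state_eq \<Omega> lam \<phi> s z u'" for u'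
  proof (rule L2_eq_of_coeffs[OF onb])
    show "L2_inner \<Omega> u' (\<phi> k) = L2_inner \<Omega> u (\<phi> k)" for k
    proof -
      have "lam k powr s * L2_inner \<Omega> u' (\<phi> k) = lam k powr s * L2_inner \<Omega> u (\<phi> k)"
        using that by (simp add: solves_state_eq_iff_coeffs[OF onb z])
      then show ?thesis using lam[of k] by simp
    qed
  qed (use that in \<open>auto simp: solves_state_eq_def Hs_def\<close>)
  then show ?thesis
    by (auto simp: is_state_def solves_state_eq_iff_coeffs[OF onb z, symmetric])
qed

section \<open>Admissible controls and the cost functional\<close>

lemma Zad_midpoint:
  assumes "z \<in> Zad \<Omega> a b" "z' \<in> Zad \<Omega> a b"
  shows "(\<lambda>x. 1/2 * (z x + z' x)) \<in> Zad \<Omega> a b"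
proof -
  have "AE x in lebesgue_on \<Omega>. a \<le> z x \<and> z x \<le> b" "AE x in lebesgue_on \<Omega>. a \<le> z' x \<and> z' x \<le> b"
    using assms by (auto simp: Zad_def)
  then have "AE x in lebesgue_on \<Omega>. a \<le> 1/2 * (z x + z' x) \<and> 1/2 * (z x + z' x) \<le> b"
    by eventually_elim auto
  moreover have "(\<lambda>x. 1/2 * (z x + z' x)) \<in> L2 \<Omega>"
    using assms unfolding Zad_def by (intro L2_intros) auto
  ultimately show ?thesis by (simp add: Zad_def)
qed

text \<open>The pointwise bounds survive an almost everywhere limit, and norm convergence supplies
  one along a subsequence. The countably many exceptional sets of the \<open>z n\<close> unite to a
  null set.\<close>

lemma Zad_closed:
  assumes z: "\<And>n. z n \<in> Zad \<Omega> a b" and g: "g \<in> L2 \<Omega>"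
    and lim: "(\<lambda>n. L2_norm \<Omega> (\<lambda>x. z n x - g x)) \<longlonglongrightarrow> 0"
  shows "g \<in> Zad \<Omega> a b"
proof -
  have "z n \<in> L2 \<Omega>" for n using z by (simp add: Zad_def)
  then obtain r where "AE x in lebesgue_on \<Omega>. (\<lambda>n. z (r n) x) \<longlonglongrightarrow> g x"
    using L2_tendsto_AE_subseq[OF _ g lim] by blast
  moreover have "AE x in lebesgue_on \<Omega>. \<forall>n. a \<le> z n x \<and> z n x \<le> b"
    using z by (simp add: Zad_def AE_all_countable)
  ultimately have "AE x in lebesgue_on \<Omega>. a \<le> g x \<and> g x \<le> b"
    by eventually_elim (auto intro: LIMSEQ_le_const LIMSEQ_le_const2)
  with g show ?thesis by (simp add: Zad_def)
qed

text \<open>The factor 1/8 is the 1/2 in front of each squared norm in \<open>cost\<close> times the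
  1/4 of the parallelogram law. The $L^1$ term contributes plain convexity.\<close>

lemma cost_midpoint_le:
  assumes fin: "finite_measure (lebesgue_on \<Omega>)" and "0 \<le> \<nu>" and d: "u\<^sub>d \<in> L2 \<Omega>"
    and u: "u \<in> L2 \<Omega>" "u' \<in> L2 \<Omega>" and z: "z \<in> L2 \<Omega>" "z' \<in> L2 \<Omega>"
  shows "cost \<Omega> \<sigma> \<nu> u\<^sub>d (\<lambda>x. 1/2 * (u x + u' x)) (\<lambda>x. 1/2 * (z x + z' x)) \<le>
    (cost \<Omega> \<sigma> \<nu> u\<^sub>d u z + cost \<Omega> \<sigma> \<nu> u\<^sub>d u' z') / 2
    - ((L2_norm \<Omega> (\<lambda>x. u x - u' x))\<^sup>2 + \<sigma> * (L2_norm \<Omega> (\<lambda>x. z x - z' x))\<^sup>2) / 8"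
proof -
  \<comment> \<open>The tracking error of the midpoint is the midpoint of the tracking
    errors.\<close>
  have "(\<lambda>x. 1/2 * (u x + u' x) - u\<^sub>d x) = (\<lambda>x. 1/2 * ((u x - u\<^sub>d x) + (u' x - u\<^sub>d x)))"
    by (simp add: field_simps)
  then have 1: "(L2_norm \<Omega> (\<lambda>x. 1/2 * (u x + u' x) - u\<^sub>d x))\<^sup>2 =
      ((L2_norm \<Omega> (\<lambda>x. u x - u\<^sub>d x))\<^sup>2 + (L2_norm \<Omega> (\<lambda>x. u' x - u\<^sub>d x))\<^sup>2) / 2
      - (L2_norm \<Omega> (\<lambda>x. u x - u' x))\<^sup>2 / 4"
    using L2_norm_midpoint_sq[OF L2_diff[OF u(1) d] L2_diff[OF u(2) d]] by simp
  have 2: "\<nu> * L1_norm \<Omega> (\<lambda>x. 1/2 * (z x + z' x)) \<le> \<nu> * ((L1_norm \<Omega> z + L1_norm \<Omega> z') / 2)"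
    using \<open>0 \<le> \<nu>\<close> by (intro mult_left_mono L1_norm_midpoint_le fin z)
  show ?thesis
    unfolding cost_def 1 L2_norm_midpoint_sq[OF z] using 2 by (simp add: field_simps)
qed

lemma cost_tendsto:
  assumes fin: "finite_measure (lebesgue_on \<Omega>)" and d: "u\<^sub>d \<in> L2 \<Omega>"
    and u: "\<And>n. u n \<in> L2 \<Omega>" "u' \<in> L2 \<Omega>" "(\<lambda>n. L2_norm \<Omega> (\<lambda>x. u n x - u' x)) \<longlonglongrightarrow> 0"
    and z: "\<And>n. z n \<in> L2 \<Omega>" "z' \<in> L2 \<Omega>" "(\<lambda>n. L2_norm \<Omega> (\<lambda>x. z n x - z' x)) \<longlonglongrightarrow> 0"
  shows "(\<lambda>n. cost \<Omega> \<sigma> \<nu> u\<^sub>d (u n) (z n)) \<longlonglongrightarrow> cost \<Omega> \<sigma> \<nu> u\<^sub>d u' z'"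
  unfolding cost_def
  by (intro tendsto_add tendsto_mult tendsto_const L2_norm_sq_tendsto L1_norm_tendsto fin L2_diff u z d)
     \<comment> \<open>In the difference of the two tracking errors, \<open>u\<^sub>d\<close>
       cancels.\<close>
     (use u in simp)

section \<open>Existence and uniqueness of the optimal pair\<close>

theorem theorem3p3:
  fixes \<Omega> :: "(real^'n) set"
    and A :: "real^'n \<Rightarrow> real^'n^'n" and c :: "real^'n \<Rightarrow> real"
    and lam :: "nat \<Rightarrow> real" and \<phi> :: "nat \<Rightarrow> real^'n \<Rightarrow> real"
    and s \<sigma> \<nu> a b :: real and u\<^sub>d :: "real^'n \<Rightarrow> real"
  assumes "bounded \<Omega>" "open \<Omega>" "convex \<Omega>" "\<Omega> \<noteq> {}" "polytope (closure \<Omega>)"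
    and "0 < s" "s < 1"
    and "\<exists>K. K-lipschitz_on \<Omega> A" "\<forall>x\<in>\<Omega>. invertible (A x)"
    and "\<forall>x\<in>\<Omega>. transpose (A x) = A x"
    and "\<exists>\<alpha>>0. \<forall>x\<in>\<Omega>. \<forall>\<xi>. \<alpha> * (norm \<xi>)\<^sup>2 \<le> (A x *v \<xi>) \<bullet> \<xi>"
    and "c \<in> borel_measurable (lebesgue_on \<Omega>)"
    and "\<exists>M. AE x in lebesgue_on \<Omega>. 0 \<le> c x \<and> c x \<le> M"
    and "\<forall>k. 0 < lam k \<and> dirichlet_eigenpair \<Omega> A c (lam k) (\<phi> k)"
    and "L2_orthonormal_basis \<Omega> \<phi>"
    and "0 < \<sigma>" "0 < \<nu>" "u\<^sub>d \<in> L2 \<Omega>" "a < 0" "0 < b"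
  shows "\<exists>u z. optimal_pair \<Omega> lam \<phi> s \<sigma> \<nu> u\<^sub>d a b u z \<and>
           (\<forall>u' z'. optimal_pair \<Omega> lam \<phi> s \<sigma> \<nu> u\<^sub>d a b u' z' \<longrightarrow> ae_eq \<Omega> u' u \<and> ae_eq \<Omega> z' z)"
proof -
  note onb = \<open>L2_orthonormal_basis \<Omega> \<phi>\<close> and \<sigma> = \<open>0 < \<sigma>\<close> and \<nu> = \<open>0 < \<nu>\<close> and d = \<open>u\<^sub>d \<in> L2 \<Omega>\<close>
  have lam: "0 < lam k" for k
    using \<open>\<forall>k. 0 < lam k \<and> _ k\<close> by simp
  have \<phi>: "\<phi> k \<in> L2 \<Omega>" for k
    using onb by (simp add: L2_orthonormal_basis_def)
  have fin: "finite_measure (lebesgue_on \<Omega>)"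
    using \<open>bounded \<Omega>\<close> \<open>open \<Omega>\<close> by (intro finite_measure_lebesgue_on lmeasurable_open)
  let ?J = "cost \<Omega> \<sigma> \<nu> u\<^sub>d"
  \<comment> \<open>The feasible pairs in coefficient form: the equations are linear in
    \<open>(u, z)\<close> and continuous in $L^2$, so they pass to midpoints and limits.\<close>
  define F where "F = {(u, z). u \<in> L2 \<Omega> \<and> z \<in> Zad \<Omega> a b \<and>
    (\<forall>k. lam k powr s * L2_inner \<Omega> u (\<phi> k) = L2_inner \<Omega> z (\<phi> k))}"
  have F_L2: "u \<in> L2 \<Omega>" "z \<in> L2 \<Omega>" if "(u, z) \<in> F" for u z
    using that by (auto simp: F_def Zad_def)
  have F_iff: "(u, z) \<in> F \<longleftrightarrow> u \<in> Hs \<Omega> lam \<phi> s \<and> z \<in> Zad \<Omega> a b \<and> is_state \<Omega> lam \<phi> s z u" for u z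
    using is_state_iff_coeffs[where lam = lam and s = s and z = z and u = u, OF onb lam]
    by (auto simp: F_def Zad_def is_state_def solves_state_eq_def)
  have optimal_iff: "optimal_pair \<Omega> lam \<phi> s \<sigma> \<nu> u\<^sub>d a b u z \<longleftrightarrow>
      (u, z) \<in> F \<and> (\<forall>u' z'. (u', z') \<in> F \<longrightarrow> ?J u z \<le> ?J u' z')" for u z
    unfolding optimal_pair_def F_iff by blast
  have F_midpoint: "(\<lambda>x. 1/2 * (u x + u' x), \<lambda>x. 1/2 * (z x + z' x)) \<in> F"
    if "(u, z) \<in> F" "(u', z') \<in> F" for u z u' z'
  proof -
    have inner: "L2_inner \<Omega> (\<lambda>x. 1/2 * (f x + g x)) (\<phi> k) =
        1/2 * (L2_inner \<Omega> f (\<phi> k) + L2_inner \<Omega> g (\<phi> k))"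
      if "f \<in> L2 \<Omega>" "g \<in> L2 \<Omega>" for f g k
      unfolding L2_inner_cmult_left L2_inner_add_left[OF that \<phi>] ..
    note L2 = F_L2[OF that(1)] F_L2[OF that(2)]
    have "(\<lambda>x. 1/2 * (u x + u' x)) \<in> L2 \<Omega>"
      by (intro L2_cmult L2_add L2)
    moreover have "(\<lambda>x. 1/2 * (z x + z' x)) \<in> Zad \<Omega> a b"
      using that by (intro Zad_midpoint) (auto simp: F_def)
    moreover have "lam k powr s * (1/2 * (L2_inner \<Omega> u (\<phi> k) + L2_inner \<Omega> u' (\<phi> k))) =
        1/2 * (L2_inner \<Omega> z (\<phi> k) + L2_inner \<Omega> z' (\<phi> k))" for k
      using that by (simp add: F_def distrib_left)
    ultimately show ?thesis
      unfolding F_def by (simp only: mem_Collect_eq case_prod_conv inner L2) blast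
  qed
  \<comment> \<open>Here \<open>m\<close> is any lower bound of the cost on \<open>F\<close>: the
    infimum for the Cauchy property, and the cost of a given minimizer for uniqueness.\<close>
  have J_midpoint: "((L2_norm \<Omega> (\<lambda>x. u x - u' x))\<^sup>2 + \<sigma> * (L2_norm \<Omega> (\<lambda>x. z x - z' x))\<^sup>2) / 8
      \<le> (?J u z + ?J u' z') / 2 - m"
    if "(u, z) \<in> F" "(u', z') \<in> F" and m: "\<forall>v w. (v, w) \<in> F \<longrightarrow> m \<le> ?J v w" for u z u' z' m
    using cost_midpoint_le[OF fin less_imp_le[OF \<nu>] d F_L2(1)[OF that(1)] F_L2(1)[OF that(2)]
        F_L2(2)[OF that(1)] F_L2(2)[OF that(2)], of \<sigma>]
      m[rule_format, OF F_midpoint[OF that(1,2)]]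
    by linarith
  \<comment> \<open>The zero control is admissible because \<open>a < 0 < b\<close>. So
    \<open>F\<close> is nonempty and the infimum below can be approximated.\<close>
  have zero: "(\<lambda>x. 0, \<lambda>x. 0) \<in> F"
    using \<open>a < 0\<close> \<open>0 < b\<close> by (auto simp: F_def Zad_def L2_zero L2_inner_def)
  define m where "m = Inf (case_prod ?J ` F)"
  have J_nonneg: "0 \<le> ?J u z" for u z
    using \<sigma> \<nu> by (simp add: cost_def L1_norm_def)
  have m_le: "\<forall>u z. (u, z) \<in> F \<longrightarrow> m \<le> ?J u z"
    unfolding m_def using J_nonneg by (intro allI impI cInf_lower bdd_belowI[of _ 0]) auto
  have "\<exists>p. p \<in> F \<and> case_prod ?J p < m + inverse (real (Suc n))" for n
  proof -
    have "Inf (case_prod ?J ` F) < m + inverse (real (Suc n))"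
      unfolding m_def[symmetric] by simp
    from cInf_lessD[OF _ this] zero show ?thesis by blast
  qed
  then obtain p where p: "\<And>n. p n \<in> F" "\<And>n. case_prod ?J (p n) < m + inverse (real (Suc n))"
    by metis
  define u z where "u n = fst (p n)" and "z n = snd (p n)" for n
  have uz: "(u n, z n) \<in> F" and J_less: "?J (u n) (z n) < m + inverse (real (Suc n))" for n
    using p[of n] by (simp_all add: u_def z_def case_prod_unfold)
  have cauchy: "\<exists>N. \<forall>i\<ge>N. \<forall>j\<ge>N.
      (L2_norm \<Omega> (\<lambda>x. u i x - u j x))\<^sup>2 + \<sigma> * (L2_norm \<Omega> (\<lambda>x. z i x - z j x))\<^sup>2 < e"
    if "e > 0" for e
  proof -
    \<comment> \<open>Two costs below \<open>m + e / 8\<close> have a mean exceeding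
      \<open>m\<close> by less than \<open>e / 8\<close>, and the 8 in \<open>J_midpoint\<close>
      cancels.\<close>
    obtain N where N: "inverse (real (Suc N)) < e / 8"
      using reals_Archimedean[of "e / 8"] \<open>e > 0\<close> by auto
    have J_close: "?J (u i) (z i) < m + e / 8" if "i \<ge> N" for i
    proof -
      have "inverse (real (Suc i)) \<le> inverse (real (Suc N))"
        using that by (intro le_imp_inverse_le) auto
      then show ?thesis using J_less[of i] N by linarith
    qed
    have "(L2_norm \<Omega> (\<lambda>x. u i x - u j x))\<^sup>2 + \<sigma> * (L2_norm \<Omega> (\<lambda>x. z i x - z j x))\<^sup>2 < e"
      if "i \<ge> N" "j \<ge> N" for i j
    proof -
      have "?J (u i) (z i) < m + e / 8" "?J (u j) (z j) < m + e / 8"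
        using that by (auto intro: J_close)
      with J_midpoint[OF uz[of i] uz[of j] m_le] show ?thesis by argo
    qed
    then show ?thesis by blast
  qed
  have "\<exists>N. \<forall>i\<ge>N. \<forall>j\<ge>N. L2_norm \<Omega> (\<lambda>x. u i x - u j x) < e" if "e > 0" for e
  proof -
    have "L2_norm \<Omega> (\<lambda>x. u i x - u j x) < e"
      if "(L2_norm \<Omega> (\<lambda>x. u i x - u j x))\<^sup>2 + \<sigma> * (L2_norm \<Omega> (\<lambda>x. z i x - z j x))\<^sup>2 < e\<^sup>2" for i j
    proof (rule power2_less_imp_less)
      have "0 \<le> \<sigma> * (L2_norm \<Omega> (\<lambda>x. z i x - z j x))\<^sup>2" using \<sigma> by simp
      with that show "(L2_norm \<Omega> (\<lambda>x. u i x - u j x))\<^sup>2 < e\<^sup>2" by linarith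
    qed (use \<open>e > 0\<close> in simp)
    then show ?thesis using cauchy[of "e\<^sup>2"] \<open>e > 0\<close> by (meson zero_less_power)
  qed
  then obtain u' where u': "u' \<in> L2 \<Omega>" "(\<lambda>n. L2_norm \<Omega> (\<lambda>x. u n x - u' x)) \<longlonglongrightarrow> 0"
    using L2_complete[of \<Omega> u, OF fin F_L2(1)[OF uz]] by blast
  have "\<exists>N. \<forall>i\<ge>N. \<forall>j\<ge>N. L2_norm \<Omega> (\<lambda>x. z i x - z j x) < e" if "e > 0" for e
  proof -
    have "L2_norm \<Omega> (\<lambda>x. z i x - z j x) < e"
      \<comment> \<open>The threshold is scaled by \<open>\<sigma>\<close> so that dividing by
        \<open>\<sigma>\<close> leaves \<open>e\<^sup>2\<close>.\<close>
      if "(L2_norm \<Omega> (\<lambda>x. u i x - u j x))\<^sup>2 + \<sigma> * (L2_norm \<Omega> (\<lambda>x. z i x - z j x))\<^sup>2 < \<sigma> * e\<^sup>2" for i j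
    proof (rule power2_less_imp_less)
      have "0 \<le> (L2_norm \<Omega> (\<lambda>x. u i x - u j x))\<^sup>2" by simp
      with that have "\<sigma> * (L2_norm \<Omega> (\<lambda>x. z i x - z j x))\<^sup>2 < \<sigma> * e\<^sup>2" by linarith
      then show "(L2_norm \<Omega> (\<lambda>x. z i x - z j x))\<^sup>2 < e\<^sup>2" using \<sigma> by simp
    qed (use \<open>e > 0\<close> in simp)
    then show ?thesis using cauchy[of "\<sigma> * e\<^sup>2"] \<open>e > 0\<close> \<sigma> by (meson mult_pos_pos zero_less_power)
  qed
  then obtain z' where z': "z' \<in> L2 \<Omega>" "(\<lambda>n. L2_norm \<Omega> (\<lambda>x. z n x - z' x)) \<longlonglongrightarrow> 0"
    using L2_complete[of \<Omega> z, OF fin F_L2(2)[OF uz]] by blast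
  have "z' \<in> Zad \<Omega> a b"
    using uz by (intro Zad_closed[OF _ z']) (auto simp: F_def)
  moreover have "lam k powr s * L2_inner \<Omega> u' (\<phi> k) = L2_inner \<Omega> z' (\<phi> k)" for k
  \<comment> \<open>Both sides are limits of the same sequence, since each \<open>(u n, z n)\<close>
    satisfies the equation.\<close>
  proof (rule LIMSEQ_unique)
    show "(\<lambda>n. lam k powr s * L2_inner \<Omega> (u n) (\<phi> k)) \<longlonglongrightarrow> lam k powr s * L2_inner \<Omega> u' (\<phi> k)"
      by (intro tendsto_mult tendsto_const L2_inner_tendsto F_L2(1)[OF uz] u' \<phi>)
    have "(\<lambda>n. L2_inner \<Omega> (z n) (\<phi> k)) \<longlonglongrightarrow> L2_inner \<Omega> z' (\<phi> k)"
      by (intro L2_inner_tendsto F_L2(2)[OF uz] z' \<phi>)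
    then show "(\<lambda>n. lam k powr s * L2_inner \<Omega> (u n) (\<phi> k)) \<longlonglongrightarrow> L2_inner \<Omega> z' (\<phi> k)"
      using uz by (simp add: F_def)
  qed
  ultimately have F': "(u', z') \<in> F"
    using u' by (simp add: F_def)
  have "(\<lambda>n. ?J (u n) (z n)) \<longlonglongrightarrow> ?J u' z'"
    by (intro cost_tendsto fin d F_L2[OF uz] u' z')
  moreover have "(\<lambda>n. m + inverse (real (Suc n))) \<longlonglongrightarrow> m"
    using tendsto_add[OF tendsto_const LIMSEQ_inverse_real_of_nat, of m] by simp
  \<comment> \<open>By continuity of the cost, the limit pair attains the infimum.\<close>
  ultimately have "?J u' z' \<le> m"
    by (rule LIMSEQ_le) (use J_less less_imp_le in blast)
  with m_le F' have opt: "optimal_pair \<Omega> lam \<phi> s \<sigma> \<nu> u\<^sub>d a b u' z'"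
    unfolding optimal_iff by (meson order_trans)
  have "ae_eq \<Omega> v u' \<and> ae_eq \<Omega> w z'" if "optimal_pair \<Omega> lam \<phi> s \<sigma> \<nu> u\<^sub>d a b v w" for v w
  proof -
    have vw: "(v, w) \<in> F" and v_min: "\<forall>v' w'. (v', w') \<in> F \<longrightarrow> ?J v w \<le> ?J v' w'"
      using that by (auto simp: optimal_iff)
    have "?J u' z' \<le> ?J v w"
      using opt vw by (simp add: optimal_iff)
    \<comment> \<open>With \<open>?J v w\<close> as the lower bound, the right-hand side is half of
      \<open>?J u' z' - ?J v w\<close>, which is at most 0.\<close>
    with J_midpoint[OF vw F' v_min]
    have "(L2_norm \<Omega> (\<lambda>x. v x - u' x))\<^sup>2 + \<sigma> * (L2_norm \<Omega> (\<lambda>x. w x - z' x))\<^sup>2 \<le> 0"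
      by (simp add: field_simps)
    moreover have "0 \<le> \<sigma> * (L2_norm \<Omega> (\<lambda>x. w x - z' x))\<^sup>2"
      using \<sigma> by simp
    ultimately have "(L2_norm \<Omega> (\<lambda>x. v x - u' x))\<^sup>2 = 0"
      and "\<sigma> * (L2_norm \<Omega> (\<lambda>x. w x - z' x))\<^sup>2 = 0"
      using zero_le_power2[of "L2_norm \<Omega> (\<lambda>x. v x - u' x)"] by linarith+
    then have "L2_norm \<Omega> (\<lambda>x. v x - u' x) = 0" "L2_norm \<Omega> (\<lambda>x. w x - z' x) = 0"
      using \<sigma> by simp_all
    then show ?thesis
      using L2_norm_eq_0_iff[OF L2_diff[OF F_L2(1)[OF vw] u'(1)]]
        L2_norm_eq_0_iff[OF L2_diff[OF F_L2(2)[OF vw] z'(1)]]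
      by (simp add: ae_eq_def)
  qed
  with opt show ?thesis by blast
qed

end
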